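(* Let $G$ be a locally compact group acting continuously on a locally compact Hausdorff space $X$. Then the $G$-space $X$ is pointwise proper if and only if for all $f\in C_0(X)$ and all $\mu\in M(X)=C_0(X)^*$ the function $$g(s)=\int_X f(sx)\,d\mu(x)\qquad (s\in G)$$ is in $C_0(G)$.
   Context: The $G$-space $X$ is pointwise proper if for every $x\in X$ and every compact $K\subset X$ the set $\{s\in G: sx\in K\}$ is compact. $M(X)$ denotes the space of (regular, finite) complex Radon measures on $X$, identified with the dual $C_0(X)^*$. *)

theory Defs
  imports "HOL-Analysis.Analysis"
begin

(* The class topological_group_add does not assume commutativity, so it covers
   non-abelian groups too; the group law is merely written s + t, with identity 0. *)
definition continuous_action ::
    "('g::topological_group_add \<Rightarrow> 'x::topological_space \<Rightarrow> 'x) \<Rightarrow> bool" where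
  "continuous_action act \<longleftrightarrow>
     (\<forall>x. act 0 x = x) \<and>
     (\<forall>s t x. act (s + t) x = act s (act t x)) \<and>
     continuous_on UNIV (\<lambda>(s, x). act s x)"

definition pointwise_proper ::
    "('g::topological_space \<Rightarrow> 'x::topological_space \<Rightarrow> 'x) \<Rightarrow> bool" where
  "pointwise_proper act \<longleftrightarrow> (\<forall>x K. compact K \<longrightarrow> compact {s. act s x \<in> K})"

definition C0 :: "('a::topological_space \<Rightarrow> complex) set" where
  "C0 = {f. continuous_on UNIV f \<and> (\<forall>\<epsilon>>0. compact {x. norm (f x) \<ge> \<epsilon>})}"

definition finite_radon_measure :: "'a::topological_space measure \<Rightarrow> bool" where
  "finite_radon_measure M \<longleftrightarrow>
     sets M = sets borel \<and> finite_measure M \<and>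
     (\<forall>A\<in>sets borel. emeasure M A = (INF U\<in>{U. open U \<and> A \<subseteq> U}. emeasure M U)) \<and>
     (\<forall>A\<in>sets borel. emeasure M A = (SUP K\<in>{K. compact K \<and> K \<subseteq> A}. emeasure M K))"

(* Countably additive set functions on the Borel sets; values off the Borel sets are irrelevant. *)
definition borel_set_measure ::
    "('a::topological_space set \<Rightarrow> 'b::real_normed_vector) \<Rightarrow> bool" where
  "borel_set_measure \<nu> \<longleftrightarrow>
     (\<forall>A::nat \<Rightarrow> 'a set. range A \<subseteq> sets borel \<longrightarrow> disjoint_family A \<longrightarrow>
        (\<lambda>n. \<nu> (A n)) sums \<nu> (\<Union>n. A n))"

(* The positive part of the Jordan decomposition of a signed measure; the negative part is the
   positive part of its negation. Note that ennreal sends negative reals to 0 and that the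
   empty set takes part in the supremum. *)
definition pos_variation :: "('a::topological_space set \<Rightarrow> real) \<Rightarrow> 'a measure" where
  "pos_variation \<nu> =
     measure_of UNIV (sets borel) (\<lambda>A. SUP B\<in>{B\<in>sets borel. B \<subseteq> A}. ennreal (\<nu> B))"

definition neg_variation :: "('a::topological_space set \<Rightarrow> real) \<Rightarrow> 'a measure" where
  "neg_variation \<nu> = pos_variation (\<lambda>A. - \<nu> A)"

(* The space M(X). Finiteness and regularity of a complex measure are those of the four Jordan
   components of its real and imaginary parts, equivalently of its total variation. *)
definition complex_radon_measures :: "('a::topological_space set \<Rightarrow> complex) set" where
  "complex_radon_measures =
     {\<mu>. borel_set_measure \<mu> \<and>
        finite_radon_measure (pos_variation (\<lambda>A. Re (\<mu> A))) \<and>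
        finite_radon_measure (neg_variation (\<lambda>A. Re (\<mu> A))) \<and>
        finite_radon_measure (pos_variation (\<lambda>A. Im (\<mu> A))) \<and>
        finite_radon_measure (neg_variation (\<lambda>A. Im (\<mu> A)))}"

definition complex_integral ::
    "('a::topological_space set \<Rightarrow> complex) \<Rightarrow> ('a \<Rightarrow> complex) \<Rightarrow> complex" where
  "complex_integral \<mu> f =
     ((\<integral>x. f x \<partial>pos_variation (\<lambda>A. Re (\<mu> A))) - (\<integral>x. f x \<partial>neg_variation (\<lambda>A. Re (\<mu> A)))) +
     \<i> * ((\<integral>x. f x \<partial>pos_variation (\<lambda>A. Im (\<mu> A))) - (\<integral>x. f x \<partial>neg_variation (\<lambda>A. Im (\<mu> A))))"

lemma sets_pos_variation [simp]: "sets (pos_variation \<nu>) = sets borel"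
  using sets.sigma_sets_eq[of borel] by (simp add: pos_variation_def sets_measure_of)

lemma borel_set_measure_empty:
  assumes "borel_set_measure \<nu>"
  shows "\<nu> {} = 0"
proof -
  have "(\<lambda>n::nat. \<nu> {}) sums \<nu> (\<Union>n::nat. {})"
    using assms unfolding borel_set_measure_def
    by (elim allE[where x="\<lambda>_. {}"]) (auto simp: disjoint_family_on_def)
  then show ?thesis by (auto simp: sums_iff summable_const_iff)
qed

lemma borel_set_measure_Un:
  assumes \<nu>: "borel_set_measure \<nu>" and "A \<in> sets borel" "B \<in> sets borel" "A \<inter> B = {}"
  shows "\<nu> (A \<union> B) = \<nu> A + \<nu> B"
proof -
  have "range (binaryset A B) \<subseteq> sets borel" using assms by (simp add: range_binaryset_eq)
  moreover have "disjoint_family (binaryset A B)"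
    using assms by (auto simp: disjoint_family_on_def binaryset_def)
  ultimately have "(\<lambda>n. \<nu> (binaryset A B n)) sums \<nu> (\<Union>n. binaryset A B n)"
    using \<nu> unfolding borel_set_measure_def by blast
  moreover have "(\<lambda>n. \<nu> (binaryset A B n)) sums (\<nu> A + \<nu> B)"
    by (rule binaryset_sums[where f = \<nu>, OF borel_set_measure_empty[OF \<nu>]])
  ultimately show ?thesis by (metis UN_binaryset_eq sums_unique2)
qed

(* measure_of falls back to the zero measure on set functions that are not measures; this shows
   that the definition of pos_variation never hits that case for countably additive arguments. *)
lemma emeasure_pos_variation:
  fixes \<nu> :: "'a::topological_space set \<Rightarrow> real"
  assumes \<nu>: "borel_set_measure \<nu>" and A: "A \<in> sets borel"
  shows "emeasure (pos_variation \<nu>) A = (SUP B\<in>{B\<in>sets borel. B \<subseteq> A}. ennreal (\<nu> B))"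
proof (rule emeasure_measure_of[OF pos_variation_def])
  let ?S = "\<lambda>A. SUP B\<in>{B\<in>sets borel. B \<subseteq> A}. ennreal (\<nu> B)"
  show "sets borel \<subseteq> Pow (UNIV :: 'a set)" "A \<in> sets (pos_variation \<nu>)"
    using A by auto
  have "{B \<in> sets borel. B \<subseteq> ({}::'a set)} = {{}}" by auto
  then show "positive (sets (pos_variation \<nu>)) ?S"
    by (auto simp: positive_def borel_set_measure_empty[OF \<nu>])
  have le: "?S A1 + ?S A2 \<le> ?S (A1 \<union> A2)"
    if A12: "A1 \<in> sets borel" "A2 \<in> sets borel" "A1 \<inter> A2 = {}" for A1 A2
  proof -
    have "ennreal (\<nu> B1) + ennreal (\<nu> B2) \<le> ?S (A1 \<union> A2)"
      if B: "B1 \<in> sets borel" "B1 \<subseteq> A1" "B2 \<in> sets borel" "B2 \<subseteq> A2" for B1 B2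
    proof -
      define C1 C2 where "C1 = (if \<nu> B1 \<ge> 0 then B1 else {})" and "C2 = (if \<nu> B2 \<ge> 0 then B2 else {})"
      have C: "C1 \<in> sets borel" "C1 \<subseteq> A1" "C2 \<in> sets borel" "C2 \<subseteq> A2" "\<nu> C1 \<ge> 0" "\<nu> C2 \<ge> 0"
          "ennreal (\<nu> B1) = ennreal (\<nu> C1)" "ennreal (\<nu> B2) = ennreal (\<nu> C2)"
        using B by (auto simp: C1_def C2_def borel_set_measure_empty[OF \<nu>] ennreal_neg)
      have "C1 \<inter> C2 = {}" using C A12 by blast
      then have "ennreal (\<nu> B1) + ennreal (\<nu> B2) = ennreal (\<nu> (C1 \<union> C2))"
        using C by (simp add: borel_set_measure_Un[OF \<nu>] ennreal_plus)
      also have "\<dots> \<le> ?S (A1 \<union> A2)" using C by (intro SUP_upper) auto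
      finally show ?thesis .
    qed
    note Un_le = this
    have ne: "{B \<in> sets borel. B \<subseteq> A} \<noteq> {}" for A :: "'a set"
      using sets.empty_sets by blast
    have *: "ennreal (\<nu> B1) + ?S A2 \<le> ?S (A1 \<union> A2)" if "B1 \<in> sets borel" "B1 \<subseteq> A1" for B1
      unfolding ennreal_SUP_add_right[OF ne] by (rule SUP_least) (simp add: Un_le that)
    show ?thesis
      unfolding ennreal_SUP_add_left[OF ne, symmetric] by (rule SUP_least) (simp add: *)
  qed
  show "countably_additive (sets (pos_variation \<nu>)) ?S"
  proof (rule countably_additiveI)
    fix A :: "nat \<Rightarrow> 'a set"
    assume "range A \<subseteq> sets (pos_variation \<nu>)" and dj: "disjoint_family A"
    then have A: "range A \<subseteq> sets borel" "\<And>i. A i \<in> sets borel" by auto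
    show "(\<Sum>i. ?S (A i)) = ?S (\<Union>i. A i)"
    proof (rule antisym)
      have fin: "(\<Sum>i<n. ?S (A i)) \<le> ?S (\<Union>i<n. A i)" for n
      proof (induction n)
        case (Suc n)
        have "A i \<inter> A n = {}" if "i < n" for i
          using dj that by (auto simp: disjoint_family_on_def dest!: bspec spec[of _ n])
        then have "(\<Union>i<n. A i) \<inter> A n = {}" by blast
        moreover have "(\<Union>i<n. A i) \<in> sets borel" using A(2) by blast
        ultimately have "?S (\<Union>i<n. A i) + ?S (A n) \<le> ?S ((\<Union>i<n. A i) \<union> A n)"
          using A(2) by (intro le)
        moreover have "(\<Union>i<n. A i) \<union> A n = (\<Union>i<Suc n. A i)"
          by (simp add: lessThan_Suc Un_commute)
        ultimately have "?S (\<Union>i<n. A i) + ?S (A n) \<le> ?S (\<Union>i<Suc n. A i)" by (simp only:)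
        then show ?case
          unfolding sum.lessThan_Suc by (rule order_trans[OF add_right_mono[OF Suc.IH]])
      qed simp
      have "?S (\<Union>i<n. A i) \<le> ?S (\<Union>i. A i)" for n
        by (rule SUP_subset_mono) blast+
      with fin have "(\<Sum>i<n. ?S (A i)) \<le> ?S (\<Union>i. A i)" for n
        by (rule order_trans)
      then show "(\<Sum>i. ?S (A i)) \<le> ?S (\<Union>i. A i)"
        by (intro suminf_le_const summableI)
    next
      show "?S (\<Union>i. A i) \<le> (\<Sum>i. ?S (A i))"
      proof (rule SUP_least, safe)
        fix B :: "'a set" assume B: "B \<in> sets borel" "B \<subseteq> (\<Union>i. A i)"
        have "range (\<lambda>i. B \<inter> A i) \<subseteq> sets borel" using A(2) B(1) by auto
        moreover have "disjoint_family (\<lambda>i. B \<inter> A i)"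
          using dj unfolding disjoint_family_on_def by blast
        ultimately have "(\<lambda>i. \<nu> (B \<inter> A i)) sums \<nu> (\<Union>i. B \<inter> A i)"
          using \<nu> unfolding borel_set_measure_def by blast
        moreover have "(\<Union>i. B \<inter> A i) = B" using B by auto
        ultimately have lim: "(\<lambda>n. \<Sum>i<n. \<nu> (B \<inter> A i)) \<longlonglongrightarrow> \<nu> B" by (simp add: sums_def)
        have "ennreal (\<Sum>i<n. \<nu> (B \<inter> A i)) \<le> (\<Sum>i. ?S (A i))" for n
        proof -
          have "ennreal (\<Sum>i<n. \<nu> (B \<inter> A i)) \<le> ennreal (\<Sum>i<n. max 0 (\<nu> (B \<inter> A i)))"
            by (intro ennreal_leI sum_mono) auto
          also have "\<dots> = (\<Sum>i<n. ennreal (\<nu> (B \<inter> A i)))"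
            using sum_ennreal[of "{..<n}" "\<lambda>i. max 0 (\<nu> (B \<inter> A i))"] by (simp add: ennreal_max_0)
          also have "\<dots> \<le> (\<Sum>i<n. ?S (A i))"
            using A(2) B(1) by (intro sum_mono SUP_upper) blast
          also have "\<dots> \<le> (\<Sum>i. ?S (A i))" by (rule sum_le_suminf) auto
          finally show ?thesis .
        qed
        moreover have "(\<lambda>n. ennreal (\<Sum>i<n. \<nu> (B \<inter> A i))) \<longlonglongrightarrow> ennreal (\<nu> B)"
          using lim by (rule tendsto_ennrealI)
        ultimately show "ennreal (\<nu> B) \<le> (\<Sum>i. ?S (A i))"
          by (meson LIMSEQ_le_const2)
      qed
    qed
  qed
qed

end

theory Submission
  imports Defs "HOL-Probability.Giry_Monad"
begin

text \<open>
  Suppose that the action is pointwise proper. A complex measure enters the integral only through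
  its four Jordan components, so let \<open>M\<close> be a finite Radon measure and let \<open>f\<close> vanish at infinity.
  The average \<open>g s = (\<integral>x. f (act s x) \<partial>M)\<close> is continuous because \<open>M\<close> is concentrated
  up to \<open>\<epsilon>\<close> on a compact set, on which the translates of \<open>f\<close> depend uniformly continuously on \<open>s\<close>
  (\<open>continuous_average\<close>). For vanishing at infinity, pointwise properness says that
  \<open>s \<mapsto> f (act s x)\<close> vanishes at infinity for each fixed \<open>x\<close>, and one would like to integrate this
  by dominated convergence. Dominated convergence holds for sequences but not for nets, and the
  group is not assumed to be \<open>\<sigma>\<close>-compact, so \<open>s \<rightarrow> \<infinity>\<close> has to be tested on sequences. This is possible
  because every closed non-compact subset of a locally compact group contains a sequence that
  meets every compact set only finitely often (\<open>escaping_sequence\<close>). Along such a sequence in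
  \<open>{s. norm (g s) \<ge> \<epsilon>}\<close> the integrals tend to 0, a contradiction (\<open>C0_average\<close>).

  Conversely, integrating against the point mass at \<open>x\<close> gives \<open>g s = f (act s x)\<close>. If \<open>f\<close> is an
  Urysohn function equal to 1 on a compact set \<open>K\<close> (\<open>C0_Urysohn\<close>), then \<open>{s. act s x \<in> K}\<close> is a closed
  subset of the compact set \<open>{s. norm (g s) \<ge> 1}\<close>.
\<close>

section \<open>Functions vanishing at infinity\<close>

lemma C0_D:
  assumes "f \<in> C0"
  shows "continuous_on UNIV f" "\<epsilon> > 0 \<Longrightarrow> compact {x. norm (f x) \<ge> \<epsilon>}"
  using assms by (auto simp: C0_def)

lemma closed_norm_superlevel:
  assumes "continuous_on UNIV f"
  shows "closed {x. (\<epsilon>::real) \<le> norm (f x)}"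
  using assms by (intro closed_Collect_le continuous_intros) auto

text \<open>The superlevel sets of a continuous function are closed, so it is enough to trap each of them
  in some compact set.\<close>

lemma C0_subset_compactI:
  assumes "continuous_on UNIV f"
    and "\<And>\<epsilon>. \<epsilon> > 0 \<Longrightarrow> \<exists>K. compact K \<and> {x. norm (f x) \<ge> \<epsilon>} \<subseteq> K"
  shows "f \<in> C0"
  unfolding C0_def
proof (intro CollectI conjI allI impI assms(1))
  fix \<epsilon> :: real assume "\<epsilon> > 0"
  then obtain K where "compact K" "{x. norm (f x) \<ge> \<epsilon>} \<subseteq> K" using assms(2) by blast
  then show "compact {x. norm (f x) \<ge> \<epsilon>}"
    using compact_Int_closed[OF _ closed_norm_superlevel[OF assms(1)]] by (metis inf.absorb2)
qed

lemma C0_bounded: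
  assumes "f \<in> C0"
  obtains B where "B \<ge> 0" "\<And>x. norm (f x) \<le> B"
proof -
  have "bounded (f ` {x. norm (f x) \<ge> 1})"
    using C0_D[OF assms] by (intro compact_imp_bounded compact_continuous_image)
      (auto intro: continuous_on_subset)
  then obtain b where b: "\<And>x. norm (f x) \<ge> 1 \<Longrightarrow> norm (f x) \<le> b"
    by (auto simp: bounded_iff)
  have "norm (f x) \<le> max 1 b" for x
    using b[of x] by linarith
  then show thesis by (intro that[of "max 1 b"]) auto
qed

lemma C0_add:
  assumes f: "f \<in> C0" and g: "g \<in> C0"
  shows "(\<lambda>x. f x + g x) \<in> C0"
proof (rule C0_subset_compactI)
  show "continuous_on UNIV (\<lambda>x. f x + g x)"
    using f g by (intro continuous_intros C0_D)
  fix \<epsilon> :: real assume \<epsilon>: "\<epsilon> > 0"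
  let ?K = "{x. norm (f x) \<ge> \<epsilon>/2} \<union> {x. norm (g x) \<ge> \<epsilon>/2}"
  have "compact ?K" using \<epsilon> f g by (intro compact_Un C0_D) auto
  moreover have "{x. norm (f x + g x) \<ge> \<epsilon>} \<subseteq> ?K"
  proof clarsimp
    fix x assume "\<epsilon> \<le> norm (f x + g x)" "\<not> \<epsilon> \<le> norm (g x) * 2"
    then show "\<epsilon> \<le> norm (f x) * 2"
      using norm_triangle_ineq[of "f x" "g x"] by linarith
  qed
  ultimately show "\<exists>K. compact K \<and> {x. norm (f x + g x) \<ge> \<epsilon>} \<subseteq> K" by blast
qed

lemma C0_cmult:
  assumes f: "f \<in> C0"
  shows "(\<lambda>x. c * f x) \<in> C0"
proof (rule C0_subset_compactI)
  show "continuous_on UNIV (\<lambda>x. c * f x)"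
    using f by (intro continuous_intros C0_D)
  fix \<epsilon> :: real assume \<epsilon>: "\<epsilon> > 0"
  show "\<exists>K. compact K \<and> {x. norm (c * f x) \<ge> \<epsilon>} \<subseteq> K"
  proof (cases "c = 0")
    case True
    then show ?thesis using \<epsilon> by (intro exI[of _ "{}"]) auto
  next
    case False
    then have "{x. norm (c * f x) \<ge> \<epsilon>} \<subseteq> {x. norm (f x) \<ge> \<epsilon> / norm c}"
      by (auto simp: norm_mult field_simps)
    then show ?thesis using C0_D(2)[OF f, of "\<epsilon> / norm c"] \<epsilon> False by auto
  qed
qed

lemma C0_diff:
  assumes "f \<in> C0" "g \<in> C0"
  shows "(\<lambda>x. f x - g x) \<in> C0"
  using C0_add[OF assms(1) C0_cmult[OF assms(2), of "-1"]] by simp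

text \<open>Local compactness gives \<open>K\<close> an open neighbourhood \<open>U\<close> inside a compact set \<open>L\<close>. A Urysohn
  function for \<open>K\<close> and \<open>- U\<close> is 0 off \<open>L\<close>, hence vanishes at infinity.\<close>

lemma C0_Urysohn:
  fixes K :: "'x::t2_space set"
  assumes lc: "locally_compact_space (euclidean :: 'x topology)" and K: "compact K"
  obtains f where "f \<in> C0" "\<And>x. x \<in> K \<Longrightarrow> f x = 1"
proof -
  have Hd: "Hausdorff_space (euclidean :: 'x topology)"
    unfolding Hausdorff_space_def by (auto simp: disjnt_def dest!: hausdorff)
  obtain U L where UL: "open U" "compact L" "K \<subseteq> U" "U \<subseteq> L"
    using lc K locally_compact_space_compact_closed_compact[of "euclidean :: 'x topology"] Hd
    by (auto simp: compactin_euclidean_iff)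
  have "completely_regular_space (euclidean :: 'x topology)"
    using lc Hd locally_compact_regular_imp_completely_regular_space by blast
  moreover have "compactin euclidean K" "closedin euclidean (- U)" "disjnt K (- U)"
    using UL K by (auto simp: compactin_euclidean_iff disjnt_def)
  ultimately obtain h :: "'x \<Rightarrow> real"
    where h: "continuous_map euclidean euclideanreal h" "h ` K \<subseteq> {1}" "h ` (- U) \<subseteq> {0}"
    by (rule Urysohn_completely_regular_compact_closed_alt)
  have "continuous_on UNIV h" using h(1) by simp
  then have "(\<lambda>x. of_real (h x)) \<in> C0"
  proof (intro C0_subset_compactI continuous_intros)
    fix \<epsilon> :: real assume "\<epsilon> > 0"
    then have "{x. norm (complex_of_real (h x)) \<ge> \<epsilon>} \<subseteq> L" using h(3) UL(4) by force
    then show "\<exists>K. compact K \<and> {x. norm (complex_of_real (h x)) \<ge> \<epsilon>} \<subseteq> K"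
      using UL(2) by blast
  qed
  then show thesis using h(2) by (intro that[of "\<lambda>x. of_real (h x)"]) auto
qed

section \<open>Sequences escaping every compact set of a group\<close>

text \<open>Fix a compact neighbourhood \<open>V\<close> of 0. Finitely many translates of \<open>V\<close> cannot cover \<open>S\<close>, so one
  can choose \<open>s n \<in> S\<close> outside all the \<open>s k + V\<close> with \<open>k < n\<close>. If \<open>W\<close> is a neighbourhood of 0 so small
  that \<open>- W + W \<subseteq> V\<close>, then each translate \<open>t + W\<close> contains at most one of the points \<open>s n\<close>, and a
  compact set is covered by finitely many such translates.\<close>

lemma escaping_sequence:
  fixes S :: "'g::{topological_group_add, t2_space} set"
  assumes lc: "locally_compact_space (euclidean :: 'g topology)"
    and S: "closed S" "\<not> compact S"
  obtains s :: "nat \<Rightarrow> 'g" where "\<And>n. s n \<in> S" "\<And>C. compact C \<Longrightarrow> finite {n. s n \<in> C}"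
proof -
  obtain U V :: "'g set" where UV: "open U" "compact V" "0 \<in> U" "U \<subseteq> V"
    using lc unfolding locally_compact_space_def
    by (simp add: compactin_euclidean_iff) (metis (no_types))
  have tr: "compact ((+) t ` V)" for t
    using UV(2) by (intro compact_continuous_image continuous_intros)
  have ex: "\<exists>r. r \<in> S \<and> (\<forall>k<n. r \<notin> (+) (s k) ` V)" for n :: nat and s
  proof (rule ccontr)
    assume "\<not> ?thesis"
    then have "S \<subseteq> (\<Union>k<n. (+) (s k) ` V)" by blast
    moreover have "compact (\<Union>k<n. (+) (s k) ` V)" using tr by (intro compact_UN) auto
    ultimately show False using S compact_Int_closed by (metis inf.absorb2)
  qed
  have "\<exists>s. \<forall>n::nat. s n \<in> S \<and> (\<forall>k<n. s n \<notin> (+) (s k) ` V)"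
    by (rule dependent_wellorder_choice[where P="\<lambda>s n r. r \<in> S \<and> (\<forall>k<n. r \<notin> (+) (s k) ` V)"])
       (simp, rule ex)
  then obtain s :: "nat \<Rightarrow> 'g" where s: "\<And>n. s n \<in> S" "\<And>n k. k < n \<Longrightarrow> s n \<notin> (+) (s k) ` V"
    by blast
  have "open ((\<lambda>p. - fst p + snd p) -` U)"
    using UV(1) by (intro open_vimage continuous_intros)
  moreover have "(0, 0) \<in> (\<lambda>p. - fst p + snd p) -` U" using UV(3) by simp
  ultimately obtain A B where AB: "open A" "open B" "(0,0) \<in> A \<times> B"
    "A \<times> B \<subseteq> (\<lambda>p. - fst p + snd p) -` U"
    by (rule open_prod_elim)
  define W where "W = A \<inter> B"
  have W: "open W" "0 \<in> W" "\<And>a b. a \<in> W \<Longrightarrow> b \<in> W \<Longrightarrow> - a + b \<in> U"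
    using AB by (auto simp: W_def)
  \<comment> \<open>the translate \<open>t + W\<close>\<close>
  define N where "N t = {z. - t + z \<in> W}" for t
  have N: "open (N t)" "t \<in> N t" for t
  proof -
    have "open ((\<lambda>z. - t + z) -` W)" using W(1) by (intro open_vimage continuous_intros)
    then show "open (N t)" by (simp add: N_def vimage_def)
    show "t \<in> N t" using W(2) by (simp add: N_def)
  qed
  have sep: "\<not> (s k \<in> N t \<and> s n \<in> N t)" if "k < n" for k n t
  proof
    assume "s k \<in> N t \<and> s n \<in> N t"
    then have "- (- t + s k) + (- t + s n) \<in> U" by (intro W(3)) (auto simp: N_def)
    then have "- s k + s n \<in> V" using UV(4) by (auto simp: minus_add add.assoc)
    then have "s k + (- s k + s n) \<in> (+) (s k) ` V" by (rule imageI)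
    then show False using s(2)[OF that] by (simp add: add.assoc[symmetric])
  qed
  have fin: "finite {n. s n \<in> N t}" for t
  proof (cases "\<exists>n. s n \<in> N t")
    case True
    then obtain n where "s n \<in> N t" by blast
    then have "{n. s n \<in> N t} \<subseteq> {n}" using sep by (auto simp: neq_iff) (metis neq_iff)
    then show ?thesis by (rule finite_subset) simp
  qed auto
  have "finite {n. s n \<in> C}" if "compact C" for C
  proof -
    have "C \<subseteq> (\<Union>t\<in>C. N t)" using N(2) by blast
    with that N(1) obtain T where T: "finite T" "C \<subseteq> (\<Union>t\<in>T. N t)"
      by (metis compactE_image)
    have "finite (\<Union>t\<in>T. {n. s n \<in> N t})" using T(1) fin by blast
    moreover have "{n. s n \<in> C} \<subseteq> (\<Union>t\<in>T. {n. s n \<in> N t})" using T(2) by blast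
    ultimately show ?thesis by (rule rev_finite_subset)
  qed
  with s(1) show thesis by (intro that) auto
qed

section \<open>Averaging over a positive Radon measure\<close>

lemma continuous_comp_act:
  assumes "continuous_action act" "continuous_on UNIV f"
  shows "continuous_on UNIV (\<lambda>p. f (act (fst p) (snd p)))"
    and "continuous_on UNIV (\<lambda>x. f (act s x))"
    and "continuous_on UNIV (\<lambda>s. f (act s x))"
proof -
  have "continuous_on UNIV (\<lambda>p. act (fst p) (snd p))"
    using assms(1) by (simp add: continuous_action_def case_prod_unfold)
  then show 1: "continuous_on UNIV (\<lambda>p. f (act (fst p) (snd p)))"
    by (rule continuous_on_compose2[OF assms(2)]) auto
  show "continuous_on UNIV (\<lambda>x. f (act s x))"
    using continuous_on_compose2[OF 1, of UNIV "\<lambda>x. (s, x)"]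
    by (simp add: continuous_on_Pair continuous_on_const continuous_on_id)
  show "continuous_on UNIV (\<lambda>s. f (act s x))"
    using continuous_on_compose2[OF 1, of UNIV "\<lambda>s. (s, x)"]
    by (simp add: continuous_on_Pair continuous_on_const continuous_on_id)
qed

lemma finite_radon_measureD:
  assumes "finite_radon_measure M"
  shows "finite_measure M" "sets M = sets borel"
    and "A \<in> sets borel \<Longrightarrow> emeasure M A = (SUP K\<in>{K. compact K \<and> K \<subseteq> A}. emeasure M K)"
proof -
  show "finite_measure M" "sets M = sets borel"
    using assms unfolding finite_radon_measure_def by blast+
  have "\<forall>A\<in>sets borel. emeasure M A = (SUP K\<in>{K. compact K \<and> K \<subseteq> A}. emeasure M K)"
    using assms unfolding finite_radon_measure_def by (elim conjE)
  then show "A \<in> sets borel \<Longrightarrow> emeasure M A = (SUP K\<in>{K. compact K \<and> K \<subseteq> A}. emeasure M K)"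
    by (rule bspec)
qed

lemma measurable_comp_act:
  assumes "continuous_action act" "finite_radon_measure M" "continuous_on UNIV f"
  shows "(\<lambda>x. f (act s x)) \<in> borel_measurable M"
  using continuous_comp_act(2)[OF assms(1,3)]
  by (simp add: measurable_cong_sets[OF finite_radon_measureD(2)[OF assms(2)] refl]
      borel_measurable_continuous_onI)

text \<open>This is inner regularity applied to the whole space.\<close>

lemma finite_radon_measure_tight:
  fixes M :: "'x::t2_space measure"
  assumes M: "finite_radon_measure M" and e: "e > 0"
  obtains K where "compact K" "measure M (- K) < e"
proof -
  interpret finite_measure M using finite_radon_measureD(1)[OF M] .
  note sets = finite_radon_measureD(2)[OF M]
  have sp: "space M = UNIV" using sets_eq_imp_space_eq[OF sets] by simp
  have SUP: "emeasure M UNIV = (SUP K\<in>{K. compact K \<and> K \<subseteq> UNIV}. emeasure M K)"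
    by (rule finite_radon_measureD(3)[OF M]) simp
  show thesis
  proof (cases "measure M UNIV = 0")
    case True
    then show thesis using e by (intro that[of "{}"]) (auto simp: Compl_eq_Diff_UNIV)
  next
    case False
    then have "ennreal (measure M UNIV - e) < ennreal (measure M UNIV)"
      using e by (intro ennreal_lessI) (auto simp: zero_less_measure_iff)
    also have "\<dots> = emeasure M UNIV" by (simp add: emeasure_eq_measure)
    finally obtain K where K: "compact K" "ennreal (measure M UNIV - e) < emeasure M K"
      unfolding SUP less_SUP_iff by auto
    have Kb: "K \<in> sets M"
      unfolding sets by (intro borel_closed compact_imp_closed K(1))
    have "measure M UNIV - e < measure M K"
      using K(2) ennreal_leI[of "measure M K" "measure M UNIV - e"]
      by (force simp: emeasure_eq_measure not_less[symmetric])
    moreover have "measure M (- K) = measure M UNIV - measure M K"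
      using finite_measure_compl[OF Kb] by (simp add: sp Compl_eq_Diff_UNIV)
    ultimately show thesis using K(1) by (intro that[of K]) auto
  qed
qed

text \<open>By the tube lemma, \<open>f (act s x)\<close> is uniformly close to \<open>f (act s0 x)\<close> for \<open>x\<close> in a compact set
  \<open>K\<close> once \<open>s\<close> is near \<open>s0\<close>; the complement of \<open>K\<close> contributes little when its measure is small,
  as \<open>f\<close> is bounded.\<close>

lemma continuous_average:
  fixes act :: "'g::{topological_group_add, t2_space} \<Rightarrow> 'x::t2_space \<Rightarrow> 'x" and f :: "'x \<Rightarrow> complex"
  assumes act: "continuous_action act" and M: "finite_radon_measure M"
    and f: "continuous_on UNIV f" and B: "\<And>x. norm (f x) \<le> B"
  shows "continuous_on UNIV (\<lambda>s. \<integral>x. f (act s x) \<partial>M)"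
proof -
  interpret finite_measure M using finite_radon_measureD(1)[OF M] .
  note sets = finite_radon_measureD(2)[OF M]
  have sp: "space M = UNIV" using sets_eq_imp_space_eq[OF sets] by simp
  have B0: "0 \<le> B" using B norm_ge_zero order_trans by blast
  have int: "integrable M (\<lambda>x. f (act s x))" for s
    using B measurable_comp_act[OF act M f] by (intro integrable_const_bound[of _ B]) auto
  show ?thesis
    unfolding continuous_on_eq_continuous_at[OF open_UNIV] continuous_at tendsto_iff
  proof (intro ballI allI impI)
    fix s0 :: 'g and e :: real assume e: "e > 0"
    \<comment> \<open>the bounds \<open>d\<close> on \<open>K\<close> and \<open>2 * B\<close> off \<open>K\<close> each contribute less than \<open>e / 2\<close>;
      the summands 1 keep the divisors positive\<close>
    define m where "m = measure M UNIV + 1"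
    have m: "m > 0" unfolding m_def by (rule add_nonneg_pos) simp_all
    define d where "d = e / (2 * m)"
    have d: "d > 0" using e m by (simp add: d_def)
    have "d * m = e / 2" using m by (simp add: d_def)
    then have dM: "d * measure M UNIV < e / 2" using d by (simp add: m_def distrib_left)
    define b where "b = B + 1"
    have b: "b > 0" using B0 by (simp add: b_def)
    define h where "h = e / (4 * b)"
    have h: "h > 0" using e b by (simp add: h_def)
    have "2 * b * h = e / 2" using b by (simp add: h_def)
    then have Bh: "2 * B * h < e / 2" using h by (simp add: b_def algebra_simps)
    obtain K where K: "compact K" "measure M (- K) < h"
      using finite_radon_measure_tight[OF M h] .
    have Kb: "- K \<in> sets M"
      unfolding sets by (intro borel_comp borel_closed compact_imp_closed K(1))
    have "continuous_on (UNIV \<times> K) (\<lambda>p. f (act (fst p) (snd p)))"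
      using continuous_comp_act(1)[OF act f] by (rule continuous_on_subset) simp
    then obtain X0 where X0: "s0 \<in> X0" "open X0"
      "\<forall>s\<in>X0 \<inter> UNIV. \<forall>x\<in>K. dist (f (act (fst (s, x)) (snd (s, x))))
        (f (act (fst (s0, x)) (snd (s0, x)))) \<le> d"
      by (rule continuous_on_prod_compactE[OF _ K(1) UNIV_I d])
    have "dist (\<integral>x. f (act s x) \<partial>M) (\<integral>x. f (act s0 x) \<partial>M) < e" if s: "s \<in> X0" for s
    proof -
      have bd: "norm (f (act s x) - f (act s0 x)) \<le> d + 2 * B * indicat_real (- K) x" for x
      proof (cases "x \<in> K")
        case True
        then show ?thesis using X0(3) s True by (simp add: dist_norm)
      next
        case False
        then show ?thesis
          using norm_triangle_ineq4[of "f (act s x)" "f (act s0 x)"] B[of "act s x"] B[of "act s0 x"] d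
          by simp
      qed
      have i2: "integrable M (\<lambda>x. d + 2 * B * indicat_real (- K) x)"
        using Kb by (intro Bochner_Integration.integrable_add integrable_const
            integrable_mult_right integrable_real_indicator) (auto simp: emeasure_eq_measure)
      have "dist (\<integral>x. f (act s x) \<partial>M) (\<integral>x. f (act s0 x) \<partial>M)
          = norm (\<integral>x. f (act s x) - f (act s0 x) \<partial>M)"
        by (simp add: dist_norm int)
      also have "\<dots> \<le> (\<integral>x. d + 2 * B * indicat_real (- K) x \<partial>M)"
        by (rule order_trans[OF integral_norm_bound integral_mono[OF integrable_norm
            [OF Bochner_Integration.integrable_diff[OF int int]] i2 bd]])
      also have "\<dots> = d * measure M UNIV + 2 * B * measure M (- K)"
        using Kb by (subst Bochner_Integration.integral_add)
          (auto simp: sp emeasure_eq_measure intro!: integrable_mult_right integrable_real_indicator)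
      also have "\<dots> \<le> d * measure M UNIV + 2 * B * h"
        using K(2) B0 by (intro add_left_mono mult_left_mono) auto
      also have "\<dots> < e" using dM Bh by linarith
      finally show ?thesis .
    qed
    then show "\<forall>\<^sub>F s in at s0. dist (\<integral>x. f (act s x) \<partial>M) (\<integral>x. f (act s0 x) \<partial>M) < e"
      using X0(1,2) unfolding eventually_at_topological by blast
  qed
qed

text \<open>If \<open>{s. norm (g s) \<ge> e}\<close> were not compact, it would contain an escaping sequence \<open>s n\<close>.
  Pointwise properness turns escaping into \<open>f (act (s n) x) \<longlonglongrightarrow> 0\<close> for every \<open>x\<close>, and dominated
  convergence contradicts \<open>norm (g (s n)) \<ge> e\<close>.\<close>

lemma C0_average:
  fixes act :: "'g::{topological_group_add, t2_space} \<Rightarrow> 'x::t2_space \<Rightarrow> 'x"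
  assumes lc: "locally_compact_space (euclidean :: 'g topology)"
    and act: "continuous_action act" and proper: "pointwise_proper act"
    and M: "finite_radon_measure M" and f: "f \<in> C0"
  shows "(\<lambda>s. \<integral>x. f (act s x) \<partial>M) \<in> C0"
proof -
  interpret finite_measure M using finite_radon_measureD(1)[OF M] .
  obtain B where B: "\<And>x. norm (f x) \<le> B" using C0_bounded[OF f] by blast
  let ?g = "\<lambda>s. \<integral>x. f (act s x) \<partial>M"
  have g: "continuous_on UNIV ?g"
    using continuous_average[OF act M C0_D(1)[OF f] B] .
  have "compact {s. norm (?g s) \<ge> e}" if e: "e > 0" for e
  proof (rule ccontr)
    assume "\<not> compact {s. norm (?g s) \<ge> e}"
    then obtain s :: "nat \<Rightarrow> 'g" where s: "\<And>n. e \<le> norm (?g (s n))"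
      "\<And>C. compact C \<Longrightarrow> finite {n. s n \<in> C}"
      using escaping_sequence[OF lc closed_norm_superlevel[OF g]] by (metis mem_Collect_eq)
    have "(\<lambda>n. f (act (s n) x)) \<longlonglongrightarrow> 0" for x
    proof (rule tendstoI)
      fix d :: real assume "d > 0"
      then have "compact {y. norm (f y) \<ge> d}" by (rule C0_D(2)[OF f])
      then have "compact {t. act t x \<in> {y. norm (f y) \<ge> d}}"
        using proper unfolding pointwise_proper_def by blast
      then have "finite {n. \<not> norm (f (act (s n) x)) < d}"
        using s(2)[of "{t. act t x \<in> {y. norm (f y) \<ge> d}}"] by (simp add: not_less)
      then show "\<forall>\<^sub>F n in sequentially. dist (f (act (s n) x)) 0 < d"
        by (simp only: eventually_cofinite cofinite_eq_sequentially[symmetric] dist_norm diff_zero)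
    qed
    then have "(\<lambda>n. ?g (s n)) \<longlonglongrightarrow> (\<integral>x. 0 \<partial>M)"
      using B measurable_comp_act[OF act M C0_D(1)[OF f]]
      by (intro integral_dominated_convergence[where w="\<lambda>_. B"]) auto
    then have "(\<lambda>n. norm (?g (s n))) \<longlonglongrightarrow> 0"
      by (auto intro: tendsto_norm_zero)
    then have "e \<le> 0" using s(1) by (intro LIMSEQ_le_const) auto
    with e show False by simp
  qed
  with g show ?thesis by (simp add: C0_def)
qed

section \<open>Point masses\<close>

definition point_mass :: "'a \<Rightarrow> 'a set \<Rightarrow> complex" where
  "point_mass x A = indicator A x"

lemma borel_set_measure_indicator:
  "borel_set_measure (\<lambda>A. c * indicator A x :: 'b::real_normed_field)"
  unfolding borel_set_measure_def
proof (intro allI impI)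
  fix A :: "nat \<Rightarrow> 'a set" assume dj: "disjoint_family A"
  show "(\<lambda>n. c * indicator (A n) x) sums (c * indicator (\<Union>n. A n) x :: 'b)"
  proof (intro sums_mult, cases "\<exists>m. x \<in> A m")
    case True
    then obtain m where m: "x \<in> A m" by blast
    have "x \<notin> A n" if "n \<noteq> m" for n
      using dj m that by (auto simp: disjoint_family_on_def)
    then have "(\<lambda>n. indicator (A n) x :: 'b) = (\<lambda>n. if n = m then 1 else 0)"
      using m by (auto simp: indicator_def)
    moreover have "indicator (\<Union>n. A n) x = (1 :: 'b)" using m by (auto simp: indicator_def)
    ultimately show "(\<lambda>n. indicator (A n) x :: 'b) sums indicator (\<Union>n. A n) x"
      using sums_single[of m "\<lambda>_. 1 :: 'b"] by simp
  qed (auto simp: indicator_def)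
qed

text \<open>The real factor \<open>c\<close> treats all Jordan components of a point mass at once: they arise for
  \<open>c = 1\<close>, \<open>c = - 1\<close> and \<open>c = 0\<close>, and \<open>ennreal c\<close> is 0 in the last two cases.\<close>

lemma pos_variation_indicator:
  fixes x :: "'a::topological_space"
  shows "pos_variation (\<lambda>A. c * indicator A x) = scale_measure (ennreal c) (return borel x)"
proof (rule measure_eqI)
  fix A assume "A \<in> sets (pos_variation (\<lambda>A. c * indicator A x))"
  then have A: "A \<in> sets borel" by simp
  have "(SUP B\<in>{B\<in>sets borel. B \<subseteq> A}. ennreal (c * indicator B x)) = ennreal c * indicator A x"
  proof (rule antisym)
    show "(SUP B\<in>{B\<in>sets borel. B \<subseteq> A}. ennreal (c * indicator B x)) \<le> ennreal c * indicator A x"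
      by (rule SUP_least) (auto simp: indicator_def)
    show "ennreal c * indicator A x \<le> (SUP B\<in>{B\<in>sets borel. B \<subseteq> A}. ennreal (c * indicator B x))"
      using A by (intro SUP_upper2[of A]) (auto simp: indicator_def)
  qed
  then show "emeasure (pos_variation (\<lambda>A. c * indicator A x)) A
      = emeasure (scale_measure (ennreal c) (return borel x)) A"
    using A by (simp add: emeasure_pos_variation[OF borel_set_measure_indicator])
qed simp

text \<open>Regularity is witnessed by explicit sets: a set without \<open>x\<close> lies in the open set \<open>- {x}\<close> of
  measure 0, and a set with \<open>x\<close> contains the compact set \<open>{x}\<close> of full measure.\<close>

lemma finite_radon_measure_scaled_return:
  fixes x :: "'a::t2_space"
  shows "finite_radon_measure (scale_measure (ennreal c) (return borel x))"
    (is "finite_radon_measure ?M")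
  unfolding finite_radon_measure_def
proof (intro conjI ballI)
  show "sets ?M = sets borel" by simp
  show "finite_measure ?M"
    by (rule finite_measureI) (simp add: space_scale_measure ennreal_mult_eq_top_iff)
  fix A :: "'a set" assume A: "A \<in> sets borel"
  show "emeasure ?M A = (INF U\<in>{U. open U \<and> A \<subseteq> U}. emeasure ?M U)"
  proof (rule antisym)
    show "emeasure ?M A \<le> (INF U\<in>{U. open U \<and> A \<subseteq> U}. emeasure ?M U)"
      by (intro INF_greatest emeasure_mono) auto
    show "(INF U\<in>{U. open U \<and> A \<subseteq> U}. emeasure ?M U) \<le> emeasure ?M A"
      using A by (intro INF_lower2[of "if x \<in> A then UNIV else - {x}"]) (auto simp: open_Compl)
  qed
  show "emeasure ?M A = (SUP K\<in>{K. compact K \<and> K \<subseteq> A}. emeasure ?M K)"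
  proof (rule antisym)
    show "(SUP K\<in>{K. compact K \<and> K \<subseteq> A}. emeasure ?M K) \<le> emeasure ?M A"
      using A by (intro SUP_least emeasure_mono) auto
    show "emeasure ?M A \<le> (SUP K\<in>{K. compact K \<and> K \<subseteq> A}. emeasure ?M K)"
      using A by (intro SUP_upper2[of "if x \<in> A then {x} else {}"]) auto
  qed
qed

lemma variations_point_mass:
  "pos_variation (\<lambda>A. Re (point_mass x A)) = return borel x"
  "neg_variation (\<lambda>A. Re (point_mass x A)) = null_measure borel"
  "pos_variation (\<lambda>A. Im (point_mass x A)) = null_measure borel"
  "neg_variation (\<lambda>A. Im (point_mass x A)) = null_measure borel"
proof -
  have re: "Re (point_mass x A) = indicator A x" and im: "Im (point_mass x A) = 0" for A
    by (auto simp: point_mass_def indicator_def)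
  show "pos_variation (\<lambda>A. Re (point_mass x A)) = return borel x"
    "neg_variation (\<lambda>A. Re (point_mass x A)) = null_measure borel"
    "pos_variation (\<lambda>A. Im (point_mass x A)) = null_measure borel"
    "neg_variation (\<lambda>A. Im (point_mass x A)) = null_measure borel"
    using pos_variation_indicator[of 1 x] pos_variation_indicator[of "-1" x]
      pos_variation_indicator[of 0 x]
    by (auto simp: re im neg_variation_def ennreal_neg intro!: measure_eqI)
qed

lemma point_mass_radon: "point_mass (x::'a::t2_space) \<in> complex_radon_measures"
proof -
  have "borel_set_measure (point_mass x)"
    using borel_set_measure_indicator[of "1::complex" x] by (simp add: point_mass_def[abs_def])
  moreover have "finite_radon_measure (return borel x)"
    using finite_radon_measure_scaled_return[of 1 x] by simp
  moreover have "finite_radon_measure (null_measure borel :: 'a measure)"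
  proof -
    have "scale_measure 0 (return borel x) = null_measure borel" by (rule measure_eqI) simp_all
    then show ?thesis using finite_radon_measure_scaled_return[of 0 x] by simp
  qed
  ultimately show ?thesis
    by (simp add: complex_radon_measures_def variations_point_mass)
qed

lemma complex_integral_point_mass:
  assumes "continuous_on UNIV f"
  shows "complex_integral (point_mass x) f = f x"
  using assms
  by (simp add: complex_integral_def variations_point_mass integral_return
      borel_measurable_continuous_onI)

section \<open>The characterisation of pointwise properness\<close>

theorem proposition3p4:
  fixes act :: "'g::{topological_group_add, t2_space} \<Rightarrow> 'x::t2_space \<Rightarrow> 'x"
  assumes "locally_compact_space (euclidean :: 'g topology)"
    and "locally_compact_space (euclidean :: 'x topology)"
    and "continuous_action act"
  shows "pointwise_proper act \<longleftrightarrow>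
    (\<forall>f \<in> C0. \<forall>\<mu> \<in> complex_radon_measures.
       (\<lambda>s. complex_integral \<mu> (\<lambda>x. f (act s x))) \<in> C0)"
proof
  assume "pointwise_proper act"
  then show "\<forall>f \<in> C0. \<forall>\<mu> \<in> complex_radon_measures.
       (\<lambda>s. complex_integral \<mu> (\<lambda>x. f (act s x))) \<in> C0"
    unfolding complex_integral_def complex_radon_measures_def
    by (intro ballI C0_add C0_diff C0_cmult C0_average assms) auto
next
  assume r: "\<forall>f \<in> C0. \<forall>\<mu> \<in> complex_radon_measures.
       (\<lambda>s. complex_integral \<mu> (\<lambda>x. f (act s x))) \<in> C0"
  show "pointwise_proper act"
    unfolding pointwise_proper_def
  proof (intro allI impI)
    fix x :: 'x and K :: "'x set" assume K: "compact K"
    obtain f where f: "f \<in> C0" "\<And>y. y \<in> K \<Longrightarrow> f y = 1"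
      using C0_Urysohn[OF assms(2) K] by blast
    have "(\<lambda>s. f (act s x)) \<in> C0"
      using bspec[OF bspec[OF r f(1)] point_mass_radon[of x]]
      by (simp add: complex_integral_point_mass
          continuous_comp_act(2)[OF assms(3) C0_D(1)[OF f(1)]])
    then have "compact {s. norm (f (act s x)) \<ge> 1}" by (rule C0_D(2)) simp
    moreover have "closed {s. act s x \<in> K}"
      using closed_vimage[OF compact_imp_closed[OF K] continuous_comp_act(3)[OF assms(3) continuous_on_id]]
      by (simp add: vimage_def)
    moreover have "{s. act s x \<in> K} \<subseteq> {s. norm (f (act s x)) \<ge> 1}" using f(2) by auto
    ultimately show "compact {s. act s x \<in> K}"
      using compact_Int_closed by (metis inf.absorb2)
  qed
qed

end
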